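(* Let $0\le\alpha\le 1$ and let $G$ be a connected graph of order $n$ having transmission degree sequence $\{Tr_1,Tr_2,\ldots,Tr_n\}$. Put $Tr_{\max}=\max_{1\le i\le n}Tr_i$ and $Tr_{\min}=\min_{1\le i\le n}Tr_i$. Then $$\Big|\alpha(Tr_{\max}-Tr_{\min})-(1-\alpha)S_D(G)\Big|\le D_\alpha S(G)\le \alpha\big(Tr_{\max}-Tr_{\min}\big)+(1-\alpha)S_D(G).$$ Equality occurs on both sides if and only if $G$ is a transmission regular graph.
   Context: All graphs are finite, undirected and simple. For a connected graph $G$ with vertices $v_1,\dots,v_n$, $d_{ij}$ is the distance between $v_i$ and $v_j$, $D(G)=(d_{ij})$ is the distance matrix, $Tr_i=\sum_{j}d_{ij}$ is the transmission of $v_i$, and $Tr(G)=\mathrm{diag}(Tr_1,\dots,Tr_n)$. $G$ is transmission regular if all $Tr_i$ are equal. For $0\le\alpha\le1$ the generalized distance matrix is $D_\alpha(G)=\alpha Tr(G)+(1-\alpha)D(G)$, with eigenvalues $\partial_1\ge\partial_2\ge\cdots\ge\partial_n$. The generalized distance spectral spread is $D_\alpha S(G)=\partial_1-\partial_n$. The distance spread is $S_D(G)=\rho_1-\rho_n$, where $\rho_1\ge\cdots\ge\rho_n$ are the eigenvalues of $D(G)$.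
   Formalization: The "only if" part of the equality characterization is stated only for 0 < α < 1, since at α = 0 and α = 1 both equalities hold for every connected graph (e.g. the non-regular path on 3 vertices); everything else is for all 0 ≤ α ≤ 1. *)

theory Defs
  imports
    "Graph_Theory.Digraph_Component"
    "Graph_Theory.Shortest_Path"
    "Jordan_Normal_Form.Char_Poly"
begin

text \<open>
  A finite simple undirected graph is an instance of the locale \<^locale>\<open>graph\<close>, where every
  edge is represented by its two opposite arcs. With unit weights, the cost of a walk is the number
  of its edges, so \<open>vdist\<close> is the usual graph distance; the conversion from
  \<^typ>\<open>ereal\<close> loses nothing when the graph is connected.
\<close>

definition vdist :: "('a, 'b) pre_digraph \<Rightarrow> 'a \<Rightarrow> 'a \<Rightarrow> real" where
  "vdist G u v = real_of_ereal (wf_digraph.\<mu> G (\<lambda>_. 1) u v)"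

definition transmission :: "('a, 'b) pre_digraph \<Rightarrow> 'a \<Rightarrow> real" where
  "transmission G u = (\<Sum>v\<in>verts G. vdist G u v)"

definition transmission_max :: "('a, 'b) pre_digraph \<Rightarrow> real" where
  "transmission_max G = Max (transmission G ` verts G)"

definition transmission_min :: "('a, 'b) pre_digraph \<Rightarrow> real" where
  "transmission_min G = Min (transmission G ` verts G)"

definition transmission_regular :: "('a, 'b) pre_digraph \<Rightarrow> bool" where
  "transmission_regular G \<longleftrightarrow>
     (\<forall>u\<in>verts G. \<forall>v\<in>verts G. transmission G u = transmission G v)"

text \<open>The list \<open>vs\<close> below enumerates the vertices without repetition; it plays the role of
  the numbering of the vertices by which rows and columns are indexed.\<close>

definition vertex_enum :: "('a, 'b) pre_digraph \<Rightarrow> 'a list \<Rightarrow> bool" where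
  "vertex_enum G vs \<longleftrightarrow> distinct vs \<and> set vs = verts G"

definition distance_matrix :: "('a, 'b) pre_digraph \<Rightarrow> 'a list \<Rightarrow> real mat" where
  "distance_matrix G vs =
     mat (length vs) (length vs) (\<lambda>(i, j). vdist G (vs ! i) (vs ! j))"

definition transmission_matrix :: "('a, 'b) pre_digraph \<Rightarrow> 'a list \<Rightarrow> real mat" where
  "transmission_matrix G vs = mat_diag (length vs) (\<lambda>i. transmission G (vs ! i))"

definition gen_distance_matrix :: "real \<Rightarrow> ('a, 'b) pre_digraph \<Rightarrow> 'a list \<Rightarrow> real mat" where
  "gen_distance_matrix \<alpha> G vs =
     \<alpha> \<cdot>\<^sub>m transmission_matrix G vs + (1 - \<alpha>) \<cdot>\<^sub>m distance_matrix G vs"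

text \<open>The real eigenvalues in non-increasing order, repeated according to algebraic multiplicity.
  For a symmetric matrix of order \<open>n \<ge> 1\<close> the list has length \<open>n\<close>, so that
  \<^const>\<open>hd\<close> and \<^const>\<open>last\<close> are its first and \<open>n\<close>-th eigenvalue.\<close>

definition eigenvalues_desc :: "real mat \<Rightarrow> real list" where
  "eigenvalues_desc A = rev (sorted_list_of_multiset (proots (char_poly A)))"

definition spectral_spread :: "real mat \<Rightarrow> real" where
  "spectral_spread A = hd (eigenvalues_desc A) - last (eigenvalues_desc A)"

definition distance_spread :: "('a, 'b) pre_digraph \<Rightarrow> 'a list \<Rightarrow> real" where
  "distance_spread G vs = spectral_spread (distance_matrix G vs)"

definition gen_distance_spread :: "real \<Rightarrow> ('a, 'b) pre_digraph \<Rightarrow> 'a list \<Rightarrow> real" where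
  "gen_distance_spread \<alpha> G vs = spectral_spread (gen_distance_matrix \<alpha> G vs)"

end

theory Submission
  imports "HOL-Analysis.Function_Topology" Defs
begin

text \<open>
  The extreme eigenvalues of a symmetric matrix are the extreme values of its Rayleigh quotient, so
  the spread is subadditive; the upper bound is subadditivity for
  \<open>D\<^sub>\<alpha> = \<alpha> Tr + (1 - \<alpha>) D\<close>, and the lower bound is subadditivity after moving one summand
  to the other side. If a bound is attained, some vector is extremal for both \<open>Tr\<close> and \<open>D\<close>;
  in every case one can be chosen that maximises the quadratic form of \<open>D\<close>. By the
  Perron-Frobenius argument such a vector has no zero entry, and being extremal for the diagonal
  matrix \<open>Tr\<close> it then forces all transmissions to coincide.
\<close>

subsection \<open>Rayleigh quotients\<close>

text \<open>The numerator of the Rayleigh quotient. Bounds on the quotient are stated below as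
  \<open>quad_form A w \<le> m * (w \<bullet> w)\<close>, which avoids division and also covers the
  zero vector.\<close>

definition quad_form :: "real mat \<Rightarrow> real vec \<Rightarrow> real" where
  "quad_form A v = v \<bullet> (A *\<^sub>v v)"

definition max_eigenvalue :: "real mat \<Rightarrow> real" where
  "max_eigenvalue A = hd (eigenvalues_desc A)"

definition min_eigenvalue :: "real mat \<Rightarrow> real" where
  "min_eigenvalue A = last (eigenvalues_desc A)"

definition symmetric_mats :: "nat \<Rightarrow> real mat set" where
  "symmetric_mats n = {A \<in> carrier_mat n n. A\<^sup>T = A}"

lemma symmetric_mats_carrier: "A \<in> symmetric_mats n \<Longrightarrow> A \<in> carrier_mat n n"
  by (simp add: symmetric_mats_def)

lemma symmetric_mats_transpose: "A \<in> symmetric_mats n \<Longrightarrow> A\<^sup>T = A"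
  by (simp add: symmetric_mats_def)

lemma symmetric_mats_add:
  assumes "A \<in> symmetric_mats n" "B \<in> symmetric_mats n"
  shows "A + B \<in> symmetric_mats n"
proof -
  have "(A + B)\<^sup>T = A + B"
    using assms transpose_add[of A n n B] by (simp only: symmetric_mats_carrier symmetric_mats_transpose)
  then show ?thesis
    using assms by (simp add: symmetric_mats_def)
qed

lemma symmetric_mats_smult:
  assumes "A \<in> symmetric_mats n"
  shows "c \<cdot>\<^sub>m A \<in> symmetric_mats n"
proof -
  have "(c \<cdot>\<^sub>m A)\<^sup>T = c \<cdot>\<^sub>m A\<^sup>T"
    by (rule eq_matI) auto
  then show ?thesis
    using assms symmetric_mats_carrier[OF assms] by (simp only: symmetric_mats_def mem_Collect_eq
        smult_carrier_mat simp_thms)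
qed

lemma scalar_prod_self_nonneg: "0 \<le> v \<bullet> (v :: real vec)"
  by (simp add: scalar_prod_def sum_nonneg)

lemma scalar_prod_self_eq_0:
  fixes v :: "real vec"
  assumes "v \<in> carrier_vec n"
  shows "v \<bullet> v = 0 \<longleftrightarrow> v = 0\<^sub>v n"
  using assms by (auto simp: scalar_prod_def sum_nonneg_eq_0_iff intro!: eq_vecI)

lemma scalar_prod_self_pos:
  fixes v :: "real vec"
  assumes "v \<in> carrier_vec n" "v \<noteq> 0\<^sub>v n"
  shows "0 < v \<bullet> v"
  using scalar_prod_self_nonneg[of v] scalar_prod_self_eq_0[OF assms(1)] assms(2) by linarith

lemma quad_form_add:
  assumes "A \<in> carrier_mat n n" "B \<in> carrier_mat n n" "v \<in> carrier_vec n"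
  shows "quad_form (A + B) v = quad_form A v + quad_form B v"
  using assms by (simp add: quad_form_def add_mult_distrib_mat_vec[of _ n n] scalar_prod_add_distrib[of _ n])

lemma smult_mat_mult_vec:
  fixes A :: "'a :: comm_semiring_0 mat"
  assumes "A \<in> carrier_mat nr nc" "v \<in> carrier_vec nc"
  shows "(c \<cdot>\<^sub>m A) *\<^sub>v v = c \<cdot>\<^sub>v (A *\<^sub>v v)"
  using assms by (intro eq_vecI) (auto simp: scalar_prod_def sum_distrib_left mult.assoc)

lemma quad_form_smult:
  assumes "A \<in> carrier_mat n n" "v \<in> carrier_vec n"
  shows "quad_form (c \<cdot>\<^sub>m A) v = c * quad_form A v"
  using assms by (simp add: quad_form_def smult_mat_mult_vec[of _ n n])

lemma quad_form_scale:
  assumes "A \<in> carrier_mat n n" "v \<in> carrier_vec n"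
  shows "quad_form A (c \<cdot>\<^sub>v v) = c\<^sup>2 * quad_form A v"
  using assms by (simp add: quad_form_def mult_mat_vec[of _ n n] power2_eq_square)

lemma quad_form_sum:
  assumes "A \<in> carrier_mat n n" "v \<in> carrier_vec n"
  shows "quad_form A v = (\<Sum>i<n. \<Sum>j<n. A $$ (i, j) * v $ i * v $ j)"
  using assms
  by (auto simp: quad_form_def scalar_prod_def sum_distrib_left lessThan_atLeast0 ac_simps
      intro!: sum.cong)

lemma symmetric_scalar_prod:
  assumes "A \<in> symmetric_mats n" "v \<in> carrier_vec n" "w \<in> carrier_vec n"
  shows "v \<bullet> (A *\<^sub>v w) = w \<bullet> (A *\<^sub>v v)"
proof -
  note A = symmetric_mats_carrier[OF assms(1)]
  have "v \<bullet> (A *\<^sub>v w) = (A *\<^sub>v v) \<bullet> w"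
    using transpose_vec_mult_scalar[OF A assms(3,2)] assms(1) by (simp add: symmetric_mats_transpose)
  also have "\<dots> = w \<bullet> (A *\<^sub>v v)"
    using A assms by (intro comm_scalar_prod[of _ n]) (auto intro: mult_mat_vec_carrier)
  finally show ?thesis .
qed

text \<open>Expansion of the form along a line; symmetry of \<open>A\<close> merges the two cross
  terms into one.\<close>

lemma quad_form_add_scaled:
  assumes "A \<in> symmetric_mats n" "v \<in> carrier_vec n" "w \<in> carrier_vec n"
  shows "quad_form A (v + t \<cdot>\<^sub>v w) = quad_form A v + 2 * t * (w \<bullet> (A *\<^sub>v v)) + t\<^sup>2 * quad_form A w"
proof -
  have [simp]: "A *\<^sub>v u \<in> carrier_vec n" for u
    using symmetric_mats_carrier[OF assms(1)] by (auto intro!: carrier_vecI)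
  have "A *\<^sub>v (v + t \<cdot>\<^sub>v w) = A *\<^sub>v v + t \<cdot>\<^sub>v (A *\<^sub>v w)"
    using assms symmetric_mats_carrier[OF assms(1)]
    by (simp add: mult_add_distrib_mat_vec[of _ n n] mult_mat_vec[of _ n n])
  then show ?thesis
    using assms symmetric_scalar_prod[OF assms]
    by (simp add: quad_form_def add_scalar_prod_distrib[of _ n] scalar_prod_add_distrib[of _ n]
        power2_eq_square algebra_simps)
qed

section \<open>Maximisers of a quadratic form\<close>

text \<open>Extreme value theorem. Vectors are transported to functions on the naturals, where
  compactness comes from Tychonoff and the form is a polynomial in the coordinates.\<close>

lemma quad_form_attains_max_on_sphere:
  assumes A: "A \<in> carrier_mat n n" and n: "0 < n"
  obtains v where "v \<in> carrier_vec n" "v \<bullet> v = 1"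
    "\<And>w. w \<in> carrier_vec n \<Longrightarrow> w \<bullet> w = 1 \<Longrightarrow> quad_form A w \<le> quad_form A v"
proof -
  txt \<open>In \<^typ>\<open>nat \<Rightarrow> real\<close> the coordinates from \<open>n\<close> on are irrelevant to \<open>f\<close>, but confining them to
    \<open>[-1, 1]\<close> makes the domain compact in the product topology.\<close>
  define B where "B = PiE (UNIV :: nat set) (\<lambda>_. {-1..1 :: real})"
  define S where "S = {x :: nat \<Rightarrow> real. (\<Sum>i<n. (x i)\<^sup>2) = 1}"
  define f where "f x = (\<Sum>i<n. \<Sum>j<n. A $$ (i, j) * x i * x j)" for x :: "nat \<Rightarrow> real"
  have "compact B"
    using compactin_PiE[of "\<lambda>_. euclidean" UNIV "\<lambda>_. {-1..1 :: real}"]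
    by (simp add: B_def euclidean_product_topology)
  moreover have "closed S"
    unfolding S_def by (intro closed_Collect_eq continuous_intros continuous_on_product_coordinates)
  ultimately have "compact (B \<inter> S)" by (rule compact_Int_closed)
  \<comment> \<open>The first unit vector shows that the domain is nonempty.\<close>
  moreover have "(\<lambda>i. if i = 0 then 1 else 0) \<in> B \<inter> S"
    using n by (auto simp: B_def S_def if_distrib[of "\<lambda>x. x\<^sup>2"] sum.If_cases)
  moreover have "continuous_on (B \<inter> S) f"
    unfolding f_def
    by (intro continuous_intros continuous_on_subset[OF continuous_on_product_coordinates]) auto
  ultimately obtain x where x: "x \<in> B \<inter> S" and max: "\<And>y. y \<in> B \<inter> S \<Longrightarrow> f y \<le> f x"
    using continuous_attains_sup[of "B \<inter> S" f] by blast
  show thesis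
  proof
    show "vec n x \<in> carrier_vec n" by simp
    show "vec n x \<bullet> vec n x = 1"
      using x by (simp add: S_def scalar_prod_def lessThan_atLeast0 power2_eq_square)
    fix w :: "real vec" assume w: "w \<in> carrier_vec n" and unit: "w \<bullet> w = 1"
    define y where "y i = (if i < n then w $ i else 0)" for i
    have y: "(\<Sum>i<n. (y i)\<^sup>2) = 1"
      using w unit by (simp add: y_def scalar_prod_def lessThan_atLeast0 power2_eq_square)
    have "\<bar>y i\<bar> \<le> 1" for i
    proof (cases "i < n")
      case True
      have "(y i)\<^sup>2 \<le> (\<Sum>i<n. (y i)\<^sup>2)"
        by (rule member_le_sum) (use True in auto)
      with y show ?thesis by (simp add: abs_square_le_1)
    qed (simp add: y_def)
    then have "y \<in> B \<inter> S" using y by (auto simp: B_def S_def abs_le_iff minus_le_iff)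
    from max[OF this] show "quad_form A w \<le> quad_form A (vec n x)"
      using w by (simp add: quad_form_sum[OF A] f_def y_def)
  qed
qed

text \<open>Both sides are homogeneous of degree 2, so the bound on the sphere extends to every
  nonzero vector by normalisation.\<close>

lemma quad_form_attains_max:
  assumes A: "A \<in> carrier_mat n n" and n: "0 < n"
  obtains v where "v \<in> carrier_vec n" "v \<bullet> v = 1"
    "\<And>w. w \<in> carrier_vec n \<Longrightarrow> quad_form A w \<le> quad_form A v * (w \<bullet> w)"
proof -
  from quad_form_attains_max_on_sphere[OF assms] obtain v where v: "v \<in> carrier_vec n" "v \<bullet> v = 1"
    and max: "\<And>w. w \<in> carrier_vec n \<Longrightarrow> w \<bullet> w = 1 \<Longrightarrow> quad_form A w \<le> quad_form A v"
    by blast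
  have "quad_form A w \<le> quad_form A v * (w \<bullet> w)" if w: "w \<in> carrier_vec n" for w
  proof (cases "w = 0\<^sub>v n")
    case True
    then show ?thesis using A by (simp add: quad_form_def scalar_prod_def)
  next
    case False
    define c where "c = 1 / sqrt (w \<bullet> w)"
    have pos: "0 < w \<bullet> w" by (rule scalar_prod_self_pos[OF w False])
    then have c2: "c\<^sup>2 = 1 / (w \<bullet> w)" by (simp add: c_def power_divide)
    have "(c \<cdot>\<^sub>v w) \<bullet> (c \<cdot>\<^sub>v w) = c\<^sup>2 * (w \<bullet> w)" using w by (simp add: power2_eq_square)
    also have "\<dots> = 1" using c2 pos by simp
    finally have "quad_form A (c \<cdot>\<^sub>v w) \<le> quad_form A v" using w by (intro max) auto
    then show ?thesis using pos by (simp add: quad_form_scale[OF A w] c2 field_simps)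
  qed
  with v that show thesis by blast
qed

lemma quad_form_max_imp_eigenvector:
  assumes A: "A \<in> symmetric_mats n" and v: "v \<in> carrier_vec n"
    and bound: "\<And>w. w \<in> carrier_vec n \<Longrightarrow> quad_form A w \<le> m * (w \<bullet> w)"
    and attained: "quad_form A v = m * (v \<bullet> v)"
  shows "A *\<^sub>v v = m \<cdot>\<^sub>v v"
proof -
  define r where "r = A *\<^sub>v v - m \<cdot>\<^sub>v v"
  have Av: "A *\<^sub>v v \<in> carrier_vec n" using symmetric_mats_carrier[OF A] v by (rule mult_mat_vec_carrier)
  then have r: "r \<in> carrier_vec n" using v by (simp add: r_def)
  define c where "c = m * (r \<bullet> r) - quad_form A r"
  have c: "0 \<le> c" using bound[OF r] by (simp add: c_def)
  \<comment> \<open>This identifies the first-order coefficient of the perturbation below with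
    \<open>r \<bullet> r\<close>.\<close>
  have rr: "r \<bullet> r = r \<bullet> (A *\<^sub>v v) - m * (r \<bullet> v)"
    using scalar_prod_minus_distrib[OF r Av, of "m \<cdot>\<^sub>v v"] v r by (simp flip: r_def)
  have sq: "(v + t \<cdot>\<^sub>v r) \<bullet> (v + t \<cdot>\<^sub>v r) = v \<bullet> v + 2 * t * (r \<bullet> v) + t\<^sup>2 * (r \<bullet> r)" for t
    using v r comm_scalar_prod[OF v r]
    by (simp add: add_scalar_prod_distrib[of _ n] scalar_prod_add_distrib[of _ n]
        power2_eq_square algebra_simps)
  txt \<open>Perturbing the maximiser \<open>v\<close> in the direction of its own residual \<open>r\<close> gives a first-order
    term that would dominate for small \<open>t\<close> unless \<open>r = 0\<close>.\<close>
  have first_order: "2 * t * (r \<bullet> r) \<le> t\<^sup>2 * c" for t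
    using bound[of "v + t \<cdot>\<^sub>v r"] v r attained
    by (simp add: quad_form_add_scaled[OF A v r] sq rr c_def algebra_simps)
  have "r \<bullet> r = 0"
  proof (rule ccontr)
    assume "r \<bullet> r \<noteq> 0"
    then have pos: "0 < r \<bullet> r" using scalar_prod_self_nonneg[of r] by linarith
    \<comment> \<open>The summand 1 keeps the denominator positive when \<open>c = 0\<close>.
      Cancelling \<open>t\<close> twice then turns \<open>first_order\<close> into
      \<open>2 * (c + 1) \<le> c\<close>.\<close>
    define t where "t = r \<bullet> r / (c + 1)"
    have t: "0 < t" "r \<bullet> r = t * (c + 1)" using pos c by (simp_all add: t_def)
    have "t * (2 * (t * (c + 1))) \<le> t * (t * c)"
      using first_order[of t] unfolding t(2) by (simp add: power2_eq_square algebra_simps)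
    then have "t * (2 * (c + 1)) \<le> t * c" using t(1) by simp
    then show False using t(1) c by simp
  qed
  then have r0: "r = 0\<^sub>v n" using scalar_prod_self_eq_0[OF r] by simp
  show ?thesis
  proof (rule eq_vecI)
    fix i assume "i < dim_vec (m \<cdot>\<^sub>v v)"
    then have i: "i < n" using v by simp
    then have "r $ i = 0" by (simp add: r0)
    then show "(A *\<^sub>v v) $ i = (m \<cdot>\<^sub>v v) $ i" using i v by (simp add: r_def)
  qed (use symmetric_mats_carrier[OF A] v in simp)
qed

section \<open>Extreme eigenvalues as extreme Rayleigh quotients\<close>

lemma eigenvalues_desc_set:
  assumes "A \<in> carrier_mat n n"
  shows "set (eigenvalues_desc A) = {k. eigenvalue A k}"
proof -
  \<comment> \<open>Monicity makes the polynomial nonzero, so that \<open>proots\<close> collects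
    exactly its roots.\<close>
  have "char_poly A \<noteq> 0" using degree_monic_char_poly[OF assms] by auto
  then show ?thesis
    by (simp add: eigenvalues_desc_def eigenvalue_root_char_poly[OF assms])
qed

lemma sorted_eigenvalues: "sorted (rev (eigenvalues_desc A))"
  by (simp add: eigenvalues_desc_def)

text \<open>An attained bound is an eigenvalue by stationarity, and every other eigenvalue is the
  quotient at its own eigenvector, hence at most \<open>m\<close>. This computes the head of the
  eigenvalue list without diagonalisation.\<close>

lemma max_eigenvalue_eqI:
  assumes A: "A \<in> symmetric_mats n" and v: "v \<in> carrier_vec n" "v \<noteq> 0\<^sub>v n"
    and bound: "\<And>w. w \<in> carrier_vec n \<Longrightarrow> quad_form A w \<le> m * (w \<bullet> w)"
    and attained: "quad_form A v = m * (v \<bullet> v)"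
  shows "max_eigenvalue A = m"
proof -
  have carr: "A \<in> carrier_mat n n" using A by (rule symmetric_mats_carrier)
  have "A *\<^sub>v v = m \<cdot>\<^sub>v v" by (rule quad_form_max_imp_eigenvector[OF A v(1) bound attained])
  then have "eigenvalue A m" using v carr by (auto simp: eigenvalue_def eigenvector_def)
  then have m: "m \<in> set (eigenvalues_desc A)" by (simp add: eigenvalues_desc_set[OF carr])
  have le: "k \<le> m" if "k \<in> set (eigenvalues_desc A)" for k
  proof -
    from that obtain w where w: "w \<in> carrier_vec n" "w \<noteq> 0\<^sub>v n" "A *\<^sub>v w = k \<cdot>\<^sub>v w"
      using carr by (auto simp: eigenvalues_desc_set[OF carr] eigenvalue_def eigenvector_def)
    then have "k * (w \<bullet> w) \<le> m * (w \<bullet> w)" using bound[of w] by (simp add: quad_form_def)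
    then show ?thesis using scalar_prod_self_pos[OF w(1,2)] by simp
  qed
  \<comment> \<open>Membership of \<open>m\<close> makes the list nonempty, so that
    \<open>hd\<close> is meaningful.\<close>
  obtain x xs where xs: "eigenvalues_desc A = x # xs" using m by (cases "eigenvalues_desc A") auto
  have "m \<le> x" using m sorted_eigenvalues[of A] by (auto simp: xs sorted_append)
  moreover have "x \<le> m" by (rule le) (simp add: xs)
  ultimately show ?thesis by (simp add: max_eigenvalue_def xs)
qed

text \<open>Dual to \<open>max_eigenvalue_eqI\<close>: the eigenvector equation comes from
  maximising the form of \<open>-A\<close>, and \<open>last\<close> is read as the head of the
  reversed list.\<close>

lemma min_eigenvalue_eqI:
  assumes A: "A \<in> symmetric_mats n" and v: "v \<in> carrier_vec n" "v \<noteq> 0\<^sub>v n"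
    and bound: "\<And>w. w \<in> carrier_vec n \<Longrightarrow> m * (w \<bullet> w) \<le> quad_form A w"
    and attained: "quad_form A v = m * (v \<bullet> v)"
  shows "min_eigenvalue A = m"
proof -
  have carr: "A \<in> carrier_mat n n" using A by (rule symmetric_mats_carrier)
  have "(-1) \<cdot>\<^sub>m A *\<^sub>v v = (- m) \<cdot>\<^sub>v v"
    by (rule quad_form_max_imp_eigenvector)
       (use A v bound attained in \<open>auto simp: quad_form_smult[OF carr] intro: symmetric_mats_smult\<close>)
  then have "(-1) \<cdot>\<^sub>v (A *\<^sub>v v) = (-1) \<cdot>\<^sub>v (m \<cdot>\<^sub>v v)"
    using carr v by (simp add: smult_mat_mult_vec[of _ n n] smult_smult_assoc)
  then have "A *\<^sub>v v = m \<cdot>\<^sub>v v"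
    by (metis smult_smult_assoc mult_minus1 minus_minus one_smult_vec)
  then have "eigenvalue A m" using v carr by (auto simp: eigenvalue_def eigenvector_def)
  then have m: "m \<in> set (eigenvalues_desc A)" by (simp add: eigenvalues_desc_set[OF carr])
  have le: "m \<le> k" if "k \<in> set (eigenvalues_desc A)" for k
  proof -
    from that obtain w where w: "w \<in> carrier_vec n" "w \<noteq> 0\<^sub>v n" "A *\<^sub>v w = k \<cdot>\<^sub>v w"
      using carr by (auto simp: eigenvalues_desc_set[OF carr] eigenvalue_def eigenvector_def)
    then have "m * (w \<bullet> w) \<le> k * (w \<bullet> w)" using bound[of w] by (simp add: quad_form_def)
    then show ?thesis using scalar_prod_self_pos[OF w(1,2)] by simp
  qed
  obtain x xs where xs: "rev (eigenvalues_desc A) = x # xs"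
    using m by (cases "rev (eigenvalues_desc A)") auto
  then have last: "last (eigenvalues_desc A) = x" by (metis last_rev list.sel(1) rev_rev_ident last_snoc rev.simps(2))
  have sets: "set (eigenvalues_desc A) = set (x # xs)" by (metis xs set_rev)
  have "x \<le> m" using m sorted_eigenvalues[of A] unfolding sets xs by auto
  moreover have "m \<le> x" by (rule le) (simp add: sets)
  ultimately show ?thesis by (simp add: min_eigenvalue_def last)
qed

text \<open>For symmetric \<open>A\<close> these are the eigenvectors of the largest eigenvalue. The
  condition uses the form rather than the eigenvector equation because tight bounds on forms can be
  added and split over a sum of matrices.\<close>

definition attains_max :: "real mat \<Rightarrow> real vec \<Rightarrow> bool" where
  "attains_max A v \<longleftrightarrow> v \<in> carrier_vec (dim_row A) \<and> v \<noteq> 0\<^sub>v (dim_row A) \<and>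
     quad_form A v = max_eigenvalue A * (v \<bullet> v)"

definition attains_min :: "real mat \<Rightarrow> real vec \<Rightarrow> bool" where
  "attains_min A v \<longleftrightarrow> v \<in> carrier_vec (dim_row A) \<and> v \<noteq> 0\<^sub>v (dim_row A) \<and>
     quad_form A v = min_eigenvalue A * (v \<bullet> v)"

text \<open>The Rayleigh principle: the maximiser found by compactness satisfies the conditions of
  \<open>max_eigenvalue_eqI\<close>.\<close>

lemma max_eigenvalue_exists:
  assumes A: "A \<in> symmetric_mats n" and n: "0 < n"
  obtains v where "attains_max A v"
    "\<And>w. w \<in> carrier_vec n \<Longrightarrow> quad_form A w \<le> max_eigenvalue A * (w \<bullet> w)"
proof -
  note carr = symmetric_mats_carrier[OF A]
  obtain v where v: "v \<in> carrier_vec n" "v \<bullet> v = 1"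
    and bound: "\<And>w. w \<in> carrier_vec n \<Longrightarrow> quad_form A w \<le> quad_form A v * (w \<bullet> w)"
    using quad_form_attains_max[OF carr n] by blast
  have nz: "v \<noteq> 0\<^sub>v n" using v by auto
  have m: "max_eigenvalue A = quad_form A v"
    by (rule max_eigenvalue_eqI[OF A v(1) nz bound]) (auto simp: v)
  show thesis
    by (rule that[of v]) (use v nz m bound carr in \<open>auto simp: attains_max_def\<close>)
qed

lemma min_eigenvalue_exists:
  assumes A: "A \<in> symmetric_mats n" and n: "0 < n"
  obtains v where "attains_min A v"
    "\<And>w. w \<in> carrier_vec n \<Longrightarrow> min_eigenvalue A * (w \<bullet> w) \<le> quad_form A w"
proof -
  note carr = symmetric_mats_carrier[OF A]
  have "(-1) \<cdot>\<^sub>m A \<in> carrier_mat n n" using carr by simp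
  from quad_form_attains_max[OF this n] obtain v where v: "v \<in> carrier_vec n" "v \<bullet> v = 1"
    and bound: "\<And>w. w \<in> carrier_vec n \<Longrightarrow>
      quad_form ((-1) \<cdot>\<^sub>m A) w \<le> quad_form ((-1) \<cdot>\<^sub>m A) v * (w \<bullet> w)"
    by blast
  have bound: "quad_form A v * (w \<bullet> w) \<le> quad_form A w" if "w \<in> carrier_vec n" for w
    using bound[OF that] that v by (simp add: quad_form_smult[OF carr])
  have nz: "v \<noteq> 0\<^sub>v n" using v by auto
  have m: "min_eigenvalue A = quad_form A v"
    by (rule min_eigenvalue_eqI[OF A v(1) nz bound]) (auto simp: v)
  show thesis
    by (rule that[of v]) (use v nz m bound carr in \<open>auto simp: attains_min_def\<close>)
qed

lemma quad_form_le_max_eigenvalue: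
  assumes "A \<in> symmetric_mats n" "w \<in> carrier_vec n"
  shows "quad_form A w \<le> max_eigenvalue A * (w \<bullet> w)"
proof (cases "n = 0")
  \<comment> \<open>The eigenvalue list is empty here and its head arbitrary, but it is multiplied
    by an empty scalar product.\<close>
  case True
  then show ?thesis using assms(2) symmetric_mats_carrier[OF assms(1)]
    by (simp add: quad_form_def scalar_prod_def)
next
  case False
  then show ?thesis using max_eigenvalue_exists[OF assms(1)] assms(2) by blast
qed

lemma quad_form_ge_min_eigenvalue:
  assumes "A \<in> symmetric_mats n" "w \<in> carrier_vec n"
  shows "min_eigenvalue A * (w \<bullet> w) \<le> quad_form A w"
proof (cases "n = 0")
  case True
  then show ?thesis using assms(2) symmetric_mats_carrier[OF assms(1)]
    by (simp add: quad_form_def scalar_prod_def)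
next
  case False
  then show ?thesis using min_eigenvalue_exists[OF assms(1)] assms(2) by blast
qed

lemma spectral_spread_eq: "spectral_spread A = max_eigenvalue A - min_eigenvalue A"
  by (simp add: spectral_spread_def max_eigenvalue_def min_eigenvalue_def)

section \<open>Extreme eigenvalues under scaling, negation and addition\<close>

text \<open>A vector extremal for \<open>A\<close> stays extremal for its multiple. The case
  \<open>c = 0\<close> is included because \<alpha> may be 0 or 1 in the bounds.\<close>

lemma eigenvalues_smult_nonneg:
  assumes A: "A \<in> symmetric_mats n" and n: "0 < n" and c: "0 \<le> c"
  shows "max_eigenvalue (c \<cdot>\<^sub>m A) = c * max_eigenvalue A"
    and "min_eigenvalue (c \<cdot>\<^sub>m A) = c * min_eigenvalue A"
proof -
  note carr = symmetric_mats_carrier[OF A]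
  note cA = symmetric_mats_smult[OF A, of c]
  obtain v where v: "attains_max A v" by (rule max_eigenvalue_exists[OF A n])
  show "max_eigenvalue (c \<cdot>\<^sub>m A) = c * max_eigenvalue A"
    by (rule max_eigenvalue_eqI[OF cA, of v])
       (use v c carr quad_form_le_max_eigenvalue[OF A] in
         \<open>auto simp: attains_max_def quad_form_smult[OF carr] mult.assoc intro!: mult_left_mono\<close>)
  obtain v where v: "attains_min A v" by (rule min_eigenvalue_exists[OF A n])
  show "min_eigenvalue (c \<cdot>\<^sub>m A) = c * min_eigenvalue A"
    by (rule min_eigenvalue_eqI[OF cA, of v])
       (use v c carr quad_form_ge_min_eigenvalue[OF A] in
         \<open>auto simp: attains_min_def quad_form_smult[OF carr] mult.assoc intro!: mult_left_mono\<close>)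
qed

lemma eigenvalues_uminus:
  assumes A: "A \<in> symmetric_mats n" and n: "0 < n"
  shows "max_eigenvalue ((-1) \<cdot>\<^sub>m A) = - min_eigenvalue A"
    and "min_eigenvalue ((-1) \<cdot>\<^sub>m A) = - max_eigenvalue A"
proof -
  note carr = symmetric_mats_carrier[OF A]
  note cA = symmetric_mats_smult[OF A, of "-1"]
  obtain v where v: "attains_min A v" by (rule min_eigenvalue_exists[OF A n])
  show "max_eigenvalue ((-1) \<cdot>\<^sub>m A) = - min_eigenvalue A"
    by (rule max_eigenvalue_eqI[OF cA, of v])
       (use v carr quad_form_ge_min_eigenvalue[OF A] in
         \<open>auto simp: attains_min_def quad_form_smult[OF carr]\<close>)
  obtain v where v: "attains_max A v" by (rule max_eigenvalue_exists[OF A n])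
  show "min_eigenvalue ((-1) \<cdot>\<^sub>m A) = - max_eigenvalue A"
    by (rule min_eigenvalue_eqI[OF cA, of v])
       (use v carr quad_form_le_max_eigenvalue[OF A] in
         \<open>auto simp: attains_max_def quad_form_smult[OF carr]\<close>)
qed

lemma attains_max_uminus:
  assumes A: "A \<in> symmetric_mats n" and n: "0 < n"
  shows "attains_max ((-1) \<cdot>\<^sub>m A) v \<longleftrightarrow> attains_min A v"
  using eigenvalues_uminus[OF assms] symmetric_mats_carrier[OF A]
  by (auto simp: attains_max_def attains_min_def quad_form_smult[OF symmetric_mats_carrier[OF A]])

lemma attains_min_uminus:
  assumes A: "A \<in> symmetric_mats n" and n: "0 < n"
  shows "attains_min ((-1) \<cdot>\<^sub>m A) v \<longleftrightarrow> attains_max A v"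
  using eigenvalues_uminus[OF assms] symmetric_mats_carrier[OF A]
  by (auto simp: attains_max_def attains_min_def quad_form_smult[OF symmetric_mats_carrier[OF A]])

text \<open>Here \<open>c\<close> must be strictly positive: for \<open>c = 0\<close> every nonzero
  vector is extremal for the multiple. This is why the equality cases ask for
  \<open>0 < \<alpha>\<close> and \<open>\<alpha> < 1\<close>.\<close>

lemma attains_smult_pos:
  assumes A: "A \<in> symmetric_mats n" and n: "0 < n" and c: "0 < c"
  shows "attains_max (c \<cdot>\<^sub>m A) v \<longleftrightarrow> attains_max A v"
    and "attains_min (c \<cdot>\<^sub>m A) v \<longleftrightarrow> attains_min A v"
  using eigenvalues_smult_nonneg[OF A n, of c] c symmetric_mats_carrier[OF A]
  by (auto simp: attains_max_def attains_min_def quad_form_smult[OF symmetric_mats_carrier[OF A]])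

text \<open>Both forms are evaluated at one maximiser of \<open>A + B\<close>. If the eigenvalues
  add up exactly, both estimates are tight at that vector.\<close>

lemma max_eigenvalue_add_le:
  assumes A: "A \<in> symmetric_mats n" and B: "B \<in> symmetric_mats n" and n: "0 < n"
  shows "max_eigenvalue (A + B) \<le> max_eigenvalue A + max_eigenvalue B"
    and "max_eigenvalue (A + B) = max_eigenvalue A + max_eigenvalue B \<Longrightarrow>
      \<exists>v. attains_max A v \<and> attains_max B v"
proof -
  note carr = symmetric_mats_carrier[OF A] symmetric_mats_carrier[OF B]
  obtain v where v: "attains_max (A + B) v"
    by (rule max_eigenvalue_exists[OF symmetric_mats_add[OF A B] n])
  then have vn: "v \<in> carrier_vec n" "v \<noteq> 0\<^sub>v n" using carr by (auto simp: attains_max_def)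
  have sum: "max_eigenvalue (A + B) * (v \<bullet> v) = quad_form A v + quad_form B v"
    using v by (simp add: attains_max_def quad_form_add[OF carr vn(1)])
  note le = quad_form_le_max_eigenvalue[OF A vn(1)] quad_form_le_max_eigenvalue[OF B vn(1)]
  have "max_eigenvalue (A + B) * (v \<bullet> v) \<le> (max_eigenvalue A + max_eigenvalue B) * (v \<bullet> v)"
    using sum le by (simp add: algebra_simps)
  then show "max_eigenvalue (A + B) \<le> max_eigenvalue A + max_eigenvalue B"
    using scalar_prod_self_pos[OF vn] by simp
  assume "max_eigenvalue (A + B) = max_eigenvalue A + max_eigenvalue B"
  then have "quad_form A v = max_eigenvalue A * (v \<bullet> v)" "quad_form B v = max_eigenvalue B * (v \<bullet> v)"
    using sum le by (simp_all add: algebra_simps)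
  then show "\<exists>v. attains_max A v \<and> attains_max B v"
    using vn carr by (auto simp: attains_max_def)
qed

lemma min_eigenvalue_add_ge:
  assumes A: "A \<in> symmetric_mats n" and B: "B \<in> symmetric_mats n" and n: "0 < n"
  shows "min_eigenvalue A + min_eigenvalue B \<le> min_eigenvalue (A + B)"
    and "min_eigenvalue (A + B) = min_eigenvalue A + min_eigenvalue B \<Longrightarrow>
      \<exists>v. attains_min A v \<and> attains_min B v"
proof -
  note A' = symmetric_mats_smult[OF A, of "-1"] and B' = symmetric_mats_smult[OF B, of "-1"]
  have eq: "(-1) \<cdot>\<^sub>m A + (-1) \<cdot>\<^sub>m B = (-1) \<cdot>\<^sub>m (A + B)"
    using symmetric_mats_carrier[OF A] symmetric_mats_carrier[OF B]
    by (intro eq_matI) auto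
  note max = max_eigenvalue_add_le[OF A' B' n, unfolded eq eigenvalues_uminus[OF A n]
      eigenvalues_uminus[OF B n] eigenvalues_uminus[OF symmetric_mats_add[OF A B] n]
      attains_max_uminus[OF A n] attains_max_uminus[OF B n]]
  show "min_eigenvalue A + min_eigenvalue B \<le> min_eigenvalue (A + B)" using max(1) by simp
  assume "min_eigenvalue (A + B) = min_eigenvalue A + min_eigenvalue B"
  then show "\<exists>v. attains_min A v \<and> attains_min B v" using max(2) by simp
qed

subsection \<open>Subadditivity of the spread\<close>

lemma spectral_spread_add_le:
  assumes A: "A \<in> symmetric_mats n" and B: "B \<in> symmetric_mats n" and n: "0 < n"
  shows "spectral_spread (A + B) \<le> spectral_spread A + spectral_spread B"
  using max_eigenvalue_add_le(1)[OF assms] min_eigenvalue_add_ge(1)[OF assms]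
  by (simp add: spectral_spread_eq)

text \<open>The inequalities for the largest and for the smallest eigenvalue add up to that for the
  spread, so equality of the spreads forces equality in each.\<close>

lemma spectral_spread_add_eq:
  assumes A: "A \<in> symmetric_mats n" and B: "B \<in> symmetric_mats n" and n: "0 < n"
    and eq: "spectral_spread (A + B) = spectral_spread A + spectral_spread B"
  shows "\<exists>v. attains_max A v \<and> attains_max B v" "\<exists>v. attains_min A v \<and> attains_min B v"
proof -
  note le = max_eigenvalue_add_le(1)[OF A B n] min_eigenvalue_add_ge(1)[OF A B n]
  show "\<exists>v. attains_max A v \<and> attains_max B v"
    by (rule max_eigenvalue_add_le(2)[OF A B n]) (use le eq in \<open>simp add: spectral_spread_eq\<close>)
  show "\<exists>v. attains_min A v \<and> attains_min B v"
    by (rule min_eigenvalue_add_ge(2)[OF A B n]) (use le eq in \<open>simp add: spectral_spread_eq\<close>)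
qed

lemma spectral_spread_uminus:
  assumes "A \<in> symmetric_mats n" "0 < n"
  shows "spectral_spread ((-1) \<cdot>\<^sub>m A) = spectral_spread A"
  using eigenvalues_uminus[OF assms] by (simp add: spectral_spread_eq)

lemma spectral_spread_smult_nonneg:
  assumes "A \<in> symmetric_mats n" "0 < n" "0 \<le> c"
  shows "spectral_spread (c \<cdot>\<^sub>m A) = c * spectral_spread A"
  using eigenvalues_smult_nonneg[OF assms] by (simp add: spectral_spread_eq right_diff_distrib)

lemma spectral_spread_nonneg:
  assumes A: "A \<in> symmetric_mats n" and n: "0 < n"
  shows "0 \<le> spectral_spread A"
proof -
  obtain v where "attains_max A v" by (rule max_eigenvalue_exists[OF A n])
  then have v: "v \<in> carrier_vec n" "v \<noteq> 0\<^sub>v n" "quad_form A v = max_eigenvalue A * (v \<bullet> v)"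
    using symmetric_mats_carrier[OF A] by (auto simp: attains_max_def)
  then have "min_eigenvalue A * (v \<bullet> v) \<le> max_eigenvalue A * (v \<bullet> v)"
    using quad_form_ge_min_eigenvalue[OF A v(1)] by simp
  then show ?thesis using scalar_prod_self_pos[OF v(1,2)] by (simp add: spectral_spread_eq)
qed

text \<open>A reverse triangle inequality: \<open>A\<close> is the sum of \<open>A + B\<close> and
  \<open>-B\<close>, \<open>B\<close> is the sum of \<open>A + B\<close> and \<open>-A\<close>, and
  negation preserves the spread.\<close>

lemma spectral_spread_add_ge:
  assumes A: "A \<in> symmetric_mats n" and B: "B \<in> symmetric_mats n" and n: "0 < n"
  shows "\<bar>spectral_spread A - spectral_spread B\<bar> \<le> spectral_spread (A + B)"
    and "\<bar>spectral_spread A - spectral_spread B\<bar> = spectral_spread (A + B) \<Longrightarrow>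
      \<exists>v. attains_min A v \<and> attains_max B v"
proof -
  note carr = symmetric_mats_carrier[OF A] symmetric_mats_carrier[OF B]
  note AB = symmetric_mats_add[OF A B]
  note A' = symmetric_mats_smult[OF A, of "-1"] and B' = symmetric_mats_smult[OF B, of "-1"]
  have A_eq: "(A + B) + (-1) \<cdot>\<^sub>m B = A" and B_eq: "(A + B) + (-1) \<cdot>\<^sub>m A = B"
    using carr by (auto intro!: eq_matI)
  note le = spectral_spread_add_le[OF AB B' n, unfolded A_eq spectral_spread_uminus[OF B n]]
    spectral_spread_add_le[OF AB A' n, unfolded B_eq spectral_spread_uminus[OF A n]]
  then show "\<bar>spectral_spread A - spectral_spread B\<bar> \<le> spectral_spread (A + B)" by linarith
  assume eq: "\<bar>spectral_spread A - spectral_spread B\<bar> = spectral_spread (A + B)"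
  \<comment> \<open>Equality for \<open>A\<close> as the sum of \<open>A + B\<close> and
    \<open>-B\<close> makes the smallest eigenvalues add up exactly; subtracting the form of
    \<open>B\<close> at \<open>v\<close> leaves the minimum of \<open>A\<close>.\<close>
  have sum: "\<exists>v. attains_min A v \<and> attains_max B v"
    if "attains_min (A + B) v" "attains_max B v"
      "spectral_spread A = spectral_spread (A + B) + spectral_spread B" for v
  proof -
    have "min_eigenvalue (A + B) = min_eigenvalue A + max_eigenvalue B"
      using that(3) max_eigenvalue_add_le(1)[OF AB B' n] min_eigenvalue_add_ge(1)[OF AB B' n]
      by (simp add: A_eq eigenvalues_uminus[OF B n] spectral_spread_eq)
    moreover have "v \<in> carrier_vec n" using that(2) carr by (simp add: attains_max_def)
    ultimately have "attains_min A v"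
      using that(1,2) carr by (auto simp: attains_min_def attains_max_def quad_form_add[OF carr] distrib_right)
    with that(2) show ?thesis by blast
  qed
  have sum': "\<exists>v. attains_min A v \<and> attains_max B v"
    if "attains_max (A + B) v" "attains_min A v"
      "spectral_spread B = spectral_spread (A + B) + spectral_spread A" for v
  proof -
    have "max_eigenvalue (A + B) = min_eigenvalue A + max_eigenvalue B"
      using that(3) max_eigenvalue_add_le(1)[OF AB A' n] min_eigenvalue_add_ge(1)[OF AB A' n]
      by (simp add: B_eq eigenvalues_uminus[OF A n] spectral_spread_eq)
    moreover have "v \<in> carrier_vec n" using that(2) carr by (simp add: attains_min_def)
    ultimately have "attains_max B v"
      using that(1,2) carr by (auto simp: attains_min_def attains_max_def quad_form_add[OF carr] distrib_right)
    with that(2) show ?thesis by blast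
  qed
  show "\<exists>v. attains_min A v \<and> attains_max B v"
  \<comment> \<open>The minimising half of \<open>spectral_spread_add_eq\<close> is taken in the
    first case and the maximising half in the second; either way the vector is maximal for
    \<open>B\<close>, as the Perron argument requires.\<close>
  proof (cases "spectral_spread B \<le> spectral_spread A")
    case True
    then have s: "spectral_spread A = spectral_spread (A + B) + spectral_spread B" using eq by linarith
    then obtain v where "attains_min (A + B) v" "attains_min ((-1) \<cdot>\<^sub>m B) v"
      using spectral_spread_add_eq(2)[OF AB B' n] by (auto simp: A_eq spectral_spread_uminus[OF B n])
    then show ?thesis using sum s attains_min_uminus[OF B n] by blast
  next
    case False
    then have s: "spectral_spread B = spectral_spread (A + B) + spectral_spread A" using eq by linarith
    then obtain v where "attains_max (A + B) v" "attains_max ((-1) \<cdot>\<^sub>m A) v"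
      using spectral_spread_add_eq(1)[OF AB A' n] by (auto simp: B_eq spectral_spread_uminus[OF A n])
    then show ?thesis using sum' s attains_max_uminus[OF A n] by blast
  qed
qed

subsection \<open>Diagonal matrices and Perron vectors\<close>

lemma quad_form_mat_diag:
  assumes "v \<in> carrier_vec n"
  shows "quad_form (mat_diag n f) v = (\<Sum>i<n. f i * (v $ i)\<^sup>2)"
proof -
  have "quad_form (mat_diag n f) v = (\<Sum>i<n. \<Sum>j<n. if i = j then f i * (v $ i)\<^sup>2 else 0)"
    unfolding quad_form_sum[OF mat_diag_dim assms]
    by (intro sum.cong) (auto simp: mat_diag_def power2_eq_square)
  then show ?thesis by simp
qed

lemma scalar_prod_self_sum:
  fixes v :: "real vec"
  assumes "v \<in> carrier_vec n"
  shows "v \<bullet> v = (\<Sum>i<n. (v $ i)\<^sup>2)"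
  using assms by (simp add: scalar_prod_def lessThan_atLeast0 power2_eq_square)

lemma mat_diag_symmetric: "mat_diag n f \<in> symmetric_mats n"
  by (auto simp: symmetric_mats_def mat_diag_def intro!: eq_matI)

text \<open>The form is a sum of the \<open>f i\<close> weighted by squares, so unit vectors at
  extreme entries are extremal.\<close>

lemma eigenvalues_mat_diag:
  assumes n: "0 < n"
  shows "max_eigenvalue (mat_diag n f) = Max (f ` {..<n})"
    and "min_eigenvalue (mat_diag n f) = Min (f ` {..<n})"
proof -
  have fin: "finite (f ` {..<n})" "f ` {..<n} \<noteq> {}" using n by auto
  have unit: "quad_form (mat_diag n f) (unit_vec n i) = f i * (unit_vec n i \<bullet> unit_vec n i)" if "i < n" for i
    using that by (simp add: quad_form_def scalar_prod_left_unit[OF mult_mat_vec_carrier[OF mat_diag_dim]])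
      (simp add: mat_diag_def)
  have nz: "unit_vec n i \<noteq> (0\<^sub>v n :: real vec)" if "i < n" for i
    using that by (metis index_unit_vec(1) index_zero_vec(1) zero_neq_one)
  obtain i where i: "i < n" "f i = Max (f ` {..<n})" using Max_in[OF fin] by auto
  show "max_eigenvalue (mat_diag n f) = Max (f ` {..<n})"
    by (rule max_eigenvalue_eqI[OF mat_diag_symmetric, of "unit_vec n i"])
       (use i fin unit nz in \<open>auto simp: quad_form_mat_diag scalar_prod_self_sum sum_distrib_left
          intro!: sum_mono mult_right_mono\<close>)
  obtain i where i: "i < n" "f i = Min (f ` {..<n})" using Min_in[OF fin] by auto
  show "min_eigenvalue (mat_diag n f) = Min (f ` {..<n})"
    by (rule min_eigenvalue_eqI[OF mat_diag_symmetric, of "unit_vec n i"])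
       (use i fin unit nz in \<open>auto simp: quad_form_mat_diag scalar_prod_self_sum sum_distrib_left
          intro!: sum_mono mult_right_mono\<close>)
qed

text \<open>The terms \<open>(m - f i) * (v $ i)\<^sup>2\<close> sum to 0 and share one sign, so
  each vanishes. The disjunction in \<open>bound\<close> serves maximisers and minimisers
  alike.\<close>

lemma mat_diag_attained_const:
  assumes v: "v \<in> carrier_vec n" and nz: "\<And>i. i < n \<Longrightarrow> v $ i \<noteq> 0"
    and eq: "quad_form (mat_diag n f) v = m * (v \<bullet> v)"
    and bound: "(\<forall>i<n. f i \<le> m) \<or> (\<forall>i<n. m \<le> f i)"
    and i: "i < n"
  shows "f i = m"
proof -
  have "(\<Sum>i<n. (m - f i) * (v $ i)\<^sup>2) = 0"
    using eq by (simp add: quad_form_mat_diag[OF v] scalar_prod_self_sum[OF v] left_diff_distrib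
        sum_subtractf sum_distrib_left)
  moreover from this have "(\<Sum>i<n. (f i - m) * (v $ i)\<^sup>2) = 0"
    by (simp add: left_diff_distrib sum_subtractf)
  ultimately have "(m - f i) * (v $ i)\<^sup>2 = 0 \<or> (f i - m) * (v $ i)\<^sup>2 = 0"
    using bound
  proof (elim disjE)
    assume "(\<Sum>i<n. (m - f i) * (v $ i)\<^sup>2) = 0" "\<forall>i<n. f i \<le> m"
    then show ?thesis using i by (subst (asm) sum_nonneg_eq_0_iff) auto
  next
    assume "(\<Sum>i<n. (f i - m) * (v $ i)\<^sup>2) = 0" "\<forall>i<n. m \<le> f i"
    then show ?thesis using i by (subst (asm) sum_nonneg_eq_0_iff) auto
  qed
  then show ?thesis using nz[OF i] by auto
qed

text \<open>Positivity is asked only off the diagonal, since a distance matrix has zero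
  diagonal.\<close>

lemma maximizer_nonzero_entries:
  assumes D: "D \<in> symmetric_mats n"
    and nonneg: "\<And>i j. i < n \<Longrightarrow> j < n \<Longrightarrow> 0 \<le> D $$ (i, j)"
    and pos: "\<And>i j. i < n \<Longrightarrow> j < n \<Longrightarrow> i \<noteq> j \<Longrightarrow> 0 < D $$ (i, j)"
    and max: "attains_max D v" and i: "i < n"
  shows "v $ i \<noteq> 0"
proof
  assume vi: "v $ i = 0"
  note carr = symmetric_mats_carrier[OF D]
  have v: "v \<in> carrier_vec n" "v \<noteq> 0\<^sub>v n" "quad_form D v = max_eigenvalue D * (v \<bullet> v)"
    using max carr by (auto simp: attains_max_def)
  txt \<open>Replacing the entries by their absolute values does not decrease the form, so \<open>u\<close> is again a
    maximiser and hence an eigenvector; row \<open>i\<close> of its eigenvalue equation has only nonnegative terms.\<close>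
  define u where "u = vec n (\<lambda>i. \<bar>v $ i\<bar>)"
  have u: "u \<in> carrier_vec n" by (simp add: u_def)
  have uu: "u \<bullet> u = v \<bullet> v"
    by (simp add: scalar_prod_self_sum[OF u] scalar_prod_self_sum[OF v(1)]) (simp add: u_def)
  have "D $$ (i, j) * v $ i * v $ j \<le> D $$ (i, j) * \<bar>v $ i\<bar> * \<bar>v $ j\<bar>" if "i < n" "j < n" for i j
    using mult_left_mono[OF abs_ge_self[of "v $ i * v $ j"] nonneg[OF that]]
    by (simp add: abs_mult mult.assoc)
  then have "quad_form D v \<le> quad_form D u"
    unfolding quad_form_sum[OF carr u] quad_form_sum[OF carr v(1)]
    by (auto simp: u_def intro!: sum_mono)
  then have "quad_form D u = max_eigenvalue D * (u \<bullet> u)"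
    using quad_form_le_max_eigenvalue[OF D u] v(3) uu by simp
  then have "D *\<^sub>v u = max_eigenvalue D \<cdot>\<^sub>v u"
    using quad_form_max_imp_eigenvector[OF D u] quad_form_le_max_eigenvalue[OF D] by blast
  then have "(D *\<^sub>v u) $ i = 0" using i vi by (simp add: u_def)
  then have "(\<Sum>j<n. D $$ (i, j) * \<bar>v $ j\<bar>) = 0"
    using carr i by (simp add: scalar_prod_def u_def lessThan_atLeast0)
  then have *: "D $$ (i, j) * \<bar>v $ j\<bar> = 0" if "j < n" for j
    using that nonneg i by (subst (asm) sum_nonneg_eq_0_iff) auto
  \<comment> \<open>Positive off-diagonal entries spread the single zero at \<open>i\<close> to all
    coordinates.\<close>
  have "v $ j = 0" if "j < n" for j
    using *[OF that] pos[OF i that] vi by (cases "i = j") auto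
  then have "v = 0\<^sub>v n" using v(1) by (intro eq_vecI) auto
  with v(2) show False by contradiction
qed

subsection \<open>Graph distances\<close>

text \<open>Each arc is replaced by an opposite one and the order reversed; this yields symmetry of
  the distance matrix.\<close>

lemma (in sym_digraph) awalk_reverse:
  assumes "awalk u p v"
  obtains q where "awalk v q u" "length q = length p"
proof -
  have "\<exists>q. awalk v q u \<and> length q = length p"
    using assms
  proof (induction p arbitrary: u)
    case Nil
    then show ?case by (auto simp: awalk_Nil_iff intro!: exI[of _ "[]"])
  next
    case (Cons e p)
    then have e: "e \<in> arcs G" "tail G e = u" and p: "awalk (head G e) p v"
      by (auto simp: awalk_Cons_iff)
    obtain e' where e': "e' \<in> arcs G" "tail G e' = head G e" "head G e' = u"
      using sym_arcs e by (force simp: symmetric_conv)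
    obtain q where q: "awalk v q (head G e)" "length q = length p"
      using Cons.IH[OF p] by blast
    have "awalk (head G e) [e'] u"
      using arc_implies_awalk[OF e'(1)] e' by simp
    then have "awalk v (q @ [e']) u" using q by simp
    then show ?case using q by (intro exI[of _ "q @ [e']"]) simp
  qed
  with that show thesis by blast
qed

lemma (in wf_digraph) awalk_cost_unit: "awalk_cost (\<lambda>_. 1) p = length p"
  by (induction p) simp_all

lemma (in sym_digraph) vdist_sym: "vdist G u v = vdist G v u"
proof -
  have "\<mu> (\<lambda>_. 1) u v \<le> \<mu> (\<lambda>_. 1) v u" for u v
    unfolding \<mu>_def
  proof (rule INF_mono)
    fix p assume "p \<in> {p. awalk v p u}"
    then obtain q where "awalk u q v" "length q = length p"
      using awalk_reverse by blast
    then show "\<exists>q\<in>{p. awalk u p v}. ereal (awalk_cost (\<lambda>_. 1) q) \<le> ereal (awalk_cost (\<lambda>_. 1) p)"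
      by (auto simp: awalk_cost_unit)
  qed
  then show ?thesis by (metis vdist_def antisym)
qed

text \<open>The infimum defining the distance is attained by a path, so it is finite and survives
  the conversion to a real.\<close>

lemma (in fin_digraph) vdist_eq_length:
  assumes "u \<rightarrow>\<^sup>* v"
  obtains p where "awalk u p v" "vdist G u v = length p"
  using min_cost_awalk[OF assms, of "\<lambda>_. 1"]
  by (auto simp: vdist_def awalk_cost_unit apath_def)

lemma (in fin_digraph) vdist_nonneg: "u \<rightarrow>\<^sup>* v \<Longrightarrow> 0 \<le> vdist G u v"
  by (metis vdist_eq_length of_nat_0_le_iff)

lemma (in fin_digraph) vdist_pos:
  assumes "u \<rightarrow>\<^sup>* v" "u \<noteq> v"
  shows "0 < vdist G u v"
proof -
  obtain p where p: "awalk u p v" "vdist G u v = length p"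
    using vdist_eq_length[OF assms(1)] .
  then have "p \<noteq> []" using assms(2) by (auto simp: awalk_Nil_iff)
  with p show ?thesis by simp
qed

lemma (in graph) connected_reachable:
  assumes "connected G" "u \<in> verts G" "v \<in> verts G"
  shows "u \<rightarrow>\<^sup>* v"
  using symmetric_connected_imp_strongly_connected[OF sym_arcs assms(1)] assms(2,3)
  by (auto simp: strongly_connected_def)

section \<open>Bounds and equality cases for the generalized distance spread\<close>

text \<open>For \<open>0 < \<alpha> < 1\<close> equality on either side alone already characterises
  regularity. At \<alpha> = 0 and \<alpha> = 1 both bounds coincide with the spread for every
  connected graph, so only the implication from regularity can hold there.\<close>

theorem theorem2p4:
  fixes G :: "('a, 'b) pre_digraph" and vs :: "'a list" and \<alpha> :: real
  defines "lower \<equiv> \<bar>\<alpha> * (transmission_max G - transmission_min G)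
                      - (1 - \<alpha>) * distance_spread G vs\<bar>"
    and "upper \<equiv> \<alpha> * (transmission_max G - transmission_min G)
                      + (1 - \<alpha>) * distance_spread G vs"
  assumes "0 \<le> \<alpha>" and "\<alpha> \<le> 1"
    and "graph G" and "connected G"
    and "vertex_enum G vs"
  shows "lower \<le> gen_distance_spread \<alpha> G vs
    \<and> gen_distance_spread \<alpha> G vs \<le> upper
    \<and> (transmission_regular G \<longrightarrow>
         lower = gen_distance_spread \<alpha> G vs \<and> gen_distance_spread \<alpha> G vs = upper)
    \<and> (0 < \<alpha> \<and> \<alpha> < 1 \<longrightarrow>
         (lower = gen_distance_spread \<alpha> G vs \<longleftrightarrow> transmission_regular G)
       \<and> (gen_distance_spread \<alpha> G vs = upper \<longleftrightarrow> transmission_regular G))"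
proof -
  interpret graph G by fact
  define n where "n = length vs"
  have verts: "verts G = set vs" "distinct vs" using assms(7) by (auto simp: vertex_enum_def)
  have "verts G \<noteq> {}" using assms(6) by (auto simp: connected_def strongly_connected_def)
  then have n: "0 < n" using verts by (auto simp: n_def)
  have reach: "vs ! i \<rightarrow>\<^sup>*\<^bsub>G\<^esub> vs ! j" if "i < n" "j < n" for i j
    using that verts by (intro connected_reachable[OF assms(6)]) (auto simp: n_def)
  define t where "t i = transmission G (vs ! i)" for i
  define T where "T = transmission_matrix G vs"
  define D where "D = distance_matrix G vs"
  have T_diag: "T = mat_diag n t" by (simp add: T_def transmission_matrix_def n_def t_def[abs_def])
  have T: "T \<in> symmetric_mats n" by (simp add: T_diag mat_diag_symmetric)
  have D_dim [simp]: "dim_row D = n" "dim_col D = n" by (simp_all add: D_def distance_matrix_def n_def)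
  have D_entry: "D $$ (i, j) = vdist G (vs ! i) (vs ! j)" if "i < n" "j < n" for i j
    using that by (simp add: D_def distance_matrix_def n_def)
  have D: "D \<in> symmetric_mats n"
    by (auto simp: symmetric_mats_def D_entry vdist_sym intro!: eq_matI)
  have images: "transmission G ` verts G = t ` {..<n}"
    by (simp add: verts t_def[abs_def] n_def set_conv_nth setcompr_eq_image image_image lessThan_def)
  have spread_T: "spectral_spread T = transmission_max G - transmission_min G"
    by (simp add: spectral_spread_eq T_diag eigenvalues_mat_diag[OF n] transmission_max_def
        transmission_min_def images)
  have regular_iff: "transmission_regular G \<longleftrightarrow> (\<forall>i<n. \<forall>j<n. t i = t j)"
    by (simp add: transmission_regular_def verts n_def t_def all_set_conv_all_nth)
  \<comment> \<open>Both equality cases end here: a maximiser for \<open>D\<close> has no zero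
    entry, and being extremal for the diagonal \<open>T\<close> it forces constant
    transmissions.\<close>
  have regularI: "transmission_regular G"
    if "attains_max D v" and tv: "attains_max T v \<or> attains_min T v" for v
  proof -
    have nz: "v $ i \<noteq> 0" if "i < n" for i
      by (rule maximizer_nonzero_entries[OF D _ _ \<open>attains_max D v\<close> that])
        (use verts in \<open>auto simp: D_entry n_def nth_eq_iff_index_eq
          intro!: vdist_nonneg vdist_pos reach[unfolded n_def]\<close>)
    have v: "v \<in> carrier_vec n" using that(1) by (simp add: attains_max_def)
    from tv have "\<exists>m. quad_form (mat_diag n t) v = m * (v \<bullet> v) \<and>
        ((\<forall>i<n. t i \<le> m) \<or> (\<forall>i<n. m \<le> t i))"
      using n by (auto simp: attains_max_def attains_min_def T_diag eigenvalues_mat_diag)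
    then obtain m where m: "quad_form (mat_diag n t) v = m * (v \<bullet> v)"
      "(\<forall>i<n. t i \<le> m) \<or> (\<forall>i<n. m \<le> t i)" by blast
    have "t i = m" if "i < n" for i
      by (rule mat_diag_attained_const[OF v nz m that])
    then show ?thesis by (simp add: regular_iff)
  qed
  define A where "A = \<alpha> \<cdot>\<^sub>m T"
  define B where "B = (1 - \<alpha>) \<cdot>\<^sub>m D"
  have A: "A \<in> symmetric_mats n" and B: "B \<in> symmetric_mats n"
    by (simp_all add: A_def B_def symmetric_mats_smult T D)
  have gen: "gen_distance_spread \<alpha> G vs = spectral_spread (A + B)"
    by (simp add: gen_distance_spread_def gen_distance_matrix_def A_def B_def T_def D_def)
  have spread_A: "spectral_spread A = \<alpha> * (transmission_max G - transmission_min G)"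
    using assms(3) by (simp add: A_def spectral_spread_smult_nonneg[OF T n] spread_T)
  have spread_B: "spectral_spread B = (1 - \<alpha>) * distance_spread G vs"
    using assms(4) spectral_spread_smult_nonneg[OF D n, of "1 - \<alpha>"]
    by (simp add: B_def distance_spread_def D_def)
  have lower: "lower = \<bar>spectral_spread A - spectral_spread B\<bar>"
    and upper: "upper = spectral_spread A + spectral_spread B"
    by (simp_all add: lower_def upper_def spread_A spread_B)
  note le = spectral_spread_add_ge(1)[OF A B n] spectral_spread_add_le[OF A B n]
  have regular: "lower = gen_distance_spread \<alpha> G vs \<and> gen_distance_spread \<alpha> G vs = upper"
    if "transmission_regular G"
  proof -
    \<comment> \<open>Constant transmissions give \<open>A\<close> spread 0, so both bounds collapse
      to the spread of \<open>B\<close>.\<close>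
    have "t ` {..<n} = (\<lambda>_. t 0) ` {..<n}"
      using that n unfolding regular_iff by (intro image_cong refl) blast
    also have "\<dots> = {t 0}" using n by auto
    finally have "spectral_spread A = 0"
      by (simp add: spread_A transmission_max_def transmission_min_def images)
    then show ?thesis
      using le spectral_spread_nonneg[OF B n] unfolding lower upper gen by linarith
  qed
  have lower_eq: "transmission_regular G"
    if \<alpha>: "0 < \<alpha>" "\<alpha> < 1" and eq: "lower = gen_distance_spread \<alpha> G vs"
  proof -
    obtain v where "attains_min A v" "attains_max B v"
      using spectral_spread_add_ge(2)[OF A B n] eq by (auto simp: lower gen)
    then have "attains_min T v" "attains_max D v"
      using \<alpha> attains_smult_pos[OF T n] attains_smult_pos[OF D n] by (auto simp: A_def B_def)
    then show ?thesis using regularI by blast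
  qed
  have upper_eq: "transmission_regular G"
    if \<alpha>: "0 < \<alpha>" "\<alpha> < 1" and eq: "gen_distance_spread \<alpha> G vs = upper"
  proof -
    \<comment> \<open>Equality also yields a common minimiser, but the Perron argument needs the
      common maximiser.\<close>
    obtain v where "attains_max A v" "attains_max B v"
      using spectral_spread_add_eq(1)[OF A B n] eq by (auto simp: upper gen)
    then have "attains_max T v" "attains_max D v"
      using \<alpha> attains_smult_pos[OF T n] attains_smult_pos[OF D n] by (auto simp: A_def B_def)
    then show ?thesis using regularI by blast
  qed
  show ?thesis
    using le regular lower_eq upper_eq unfolding lower[symmetric] upper[symmetric] gen[symmetric] by blast
qed

end
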